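(* If $c<1$, it holds that $$g(x)\simeq_{x\to0,\,x>0}\ \frac1\pi\,\frac1{\sqrt{c(1-c)}}\,\frac1M\mathrm{Tr}(R^{-1})\,\frac1{\sqrt x},$$ while if $c=1$, it holds that $$g(x)\simeq_{x\to0,\,x>0}\ \frac1\pi\,\frac{\sqrt3}2\left(\frac1M\mathrm{Tr}(R^{-1})\right)^{2/3}\frac1{x^{2/3}} .$$
   Context: $M,N,L\ge1$ are integers, $c=ML/N$, and $R$ is an $M\times M$ Hermitian matrix with $aI_M\le R<bI_M$, $0<a<b$. For $z\in\mathbb{C}^+$ (open upper half plane), $t(z)$ is the unique solution with $t(z)\in\mathbb{C}^+$, $zt(z)\in\mathbb{C}^+$ of $t(z)=\frac1M\mathrm{Tr}\,R\left(-zI_M-\frac{zct(z)}{1-zc^2t(z)^2}R\right)^{-1}$, and $T(z)=-\left(zI_M+\frac{zct(z)}{1-zc^2t(z)^2}R\right)^{-1}$. The function $t_\nu(z)=\frac1M\mathrm{Tr}\,T(z)$ is the Stieltjes transform $\int\frac{d\nu(\lambda)}{\lambda-z}$ of a probability measure $\nu$ on $[0,\infty)$, which can be written $d\nu(x)=g(x)\,dx+\nu(\{0\})\delta_0$, where for $x>0$, $g(x)=\frac1\pi\mathrm{Im}\,t_\nu(x)$ with $t_\nu(x)=\lim_{z\to x,\,z\in\mathbb{C}^+}t_\nu(z)$. $A(x)\simeq B(x)$ means $A(x)/B(x)\to1$. *)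

theory Defs
  imports "HOL-Analysis.Analysis" "HOL-Library.Landau_Symbols"
begin

(* Complex M x M matrices are elements of complex^'m^'m, with M = CARD('m).
   mat k is k times the identity, so mat k ** A is the scalar multiple k A. *)

definition hermitian :: "complex^'m^'m \<Rightarrow> bool" where
  "hermitian A \<longleftrightarrow> (\<chi> i j. cnj (A $ j $ i)) = A"

definition quad_form :: "complex^'m^'m \<Rightarrow> complex^'m \<Rightarrow> complex" where
  "quad_form A v = (\<Sum>i\<in>UNIV. cnj (v $ i) * (A *v v) $ i)"

(* quad_form A v is real for Hermitian A, so taking Re loses nothing. *)

definition psd :: "complex^'m^'m \<Rightarrow> bool" where
  "psd A \<longleftrightarrow> hermitian A \<and> (\<forall>v. 0 \<le> Re (quad_form A v))"

definition posdef :: "complex^'m^'m \<Rightarrow> bool" where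
  "posdef A \<longleftrightarrow> hermitian A \<and> (\<forall>v. v \<noteq> 0 \<longrightarrow> 0 < Re (quad_form A v))"

definition loewner_le :: "complex^'m^'m \<Rightarrow> complex^'m^'m \<Rightarrow> bool" where
  "loewner_le A B \<longleftrightarrow> psd (B - A)"

definition loewner_less :: "complex^'m^'m \<Rightarrow> complex^'m^'m \<Rightarrow> bool" where
  "loewner_less A B \<longleftrightarrow> posdef (B - A)"

definition upper_half_plane :: "complex set" where
  "upper_half_plane = {z. 0 < Im z}"

definition ntrace :: "complex^'m^'m \<Rightarrow> complex" where
  "ntrace A = trace A / of_nat CARD('m)"

definition coeff_R :: "real \<Rightarrow> complex \<Rightarrow> complex \<Rightarrow> complex" where
  "coeff_R c z t = z * of_real c * t / (1 - z * (of_real c)\<^sup>2 * t\<^sup>2)"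

(* For R positive definite, c > 0 and z, t, z * t in the upper half plane, every square
   root of z * t^2 is non-real; hence the denominator in coeff_R is nonzero, and the matrix
   below is invertible.  So the conventions x / 0 = 0 and matrix_inv of a
   singular matrix play no role. *)

definition is_t_solution :: "real \<Rightarrow> complex^'m^'m \<Rightarrow> complex \<Rightarrow> complex \<Rightarrow> bool" where
  "is_t_solution c R z t \<longleftrightarrow>
     t \<in> upper_half_plane \<and> z * t \<in> upper_half_plane \<and>
     t = ntrace (R ** matrix_inv (- mat z - mat (coeff_R c z t) ** R))"

definition t_sol :: "real \<Rightarrow> complex^'m^'m \<Rightarrow> complex \<Rightarrow> complex" where
  "t_sol c R z = (THE t. is_t_solution c R z t)"

definition T_mat :: "real \<Rightarrow> complex^'m^'m \<Rightarrow> complex \<Rightarrow> complex^'m^'m" where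
  "T_mat c R z = - matrix_inv (mat z + mat (coeff_R c z (t_sol c R z)) ** R)"

definition t_nu :: "real \<Rightarrow> complex^'m^'m \<Rightarrow> complex \<Rightarrow> complex" where
  "t_nu c R z = ntrace (T_mat c R z)"

definition t_nu_boundary :: "real \<Rightarrow> complex^'m^'m \<Rightarrow> real \<Rightarrow> complex" where
  "t_nu_boundary c R x = Lim (at (of_real x) within upper_half_plane) (t_nu c R)"

(* Density on (0, \<infinity>) of the measure nu whose Stieltjes transform is t_nu,
   given by Stieltjes inversion; only its values at x > 0 are meaningful. *)

definition g_density :: "real \<Rightarrow> complex^'m^'m \<Rightarrow> real \<Rightarrow> real" where
  "g_density c R x = Im (t_nu_boundary c R x) / pi"

end

theory Submission
  imports Defs "HOL-Complex_Analysis.Complex_Analysis" "HOL-Real_Asymp.Real_Asymp"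
begin

text \<open>
  Let \<open>l\<close> be the family of eigenvalues of \<open>R\<close>, which are positive, and let \<open>mean\<close> denote the average
  over the spectrum.  In an eigenbasis the matrix equation for \<open>t\<close> becomes the scalar equation
  \<open>t = mean (l / (- z - k l))\<close>, where \<open>k\<close> is the coefficient of \<open>R\<close> in the resolvent, a function of
  \<open>z\<close> and \<open>t\<close>.

  There is no closed formula for \<open>t\<close> in general, but in the variable \<open>v = z / k\<close> the equation can be solved for \<open>z\<close>:
  with \<open>phi v = mean (l / (l + v))\<close> and \<open>psi v = mean (1 / (l + v))\<close> it says
    \<open>z = - c v\<^sup>2 phi v (1 - c phi v)\<close>,  \<open>t = - (v / z) phi v\<close>,  \<open>t_nu = - (v / z) psi v\<close>,
  and both \<open>t\<close> and \<open>z t\<close> lie in the upper half plane as soon as \<open>v\<close> and \<open>v / z\<close> lie in the lower one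
  (\<open>solves_of_parameter\<close>).  Put \<open>\<mu> = psi 0\<close>, the normalised trace of the inverse of \<open>R\<close>.  Since
  \<open>phi 0 = 1\<close> and \<open>1 - phi v = v psi v\<close>, near \<open>v = 0\<close> the first relation reads
  \<open>z \<approx> - c (1 - c) v\<^sup>2\<close> for \<open>c < 1\<close> and \<open>z \<approx> - \<mu> v\<^sup>3\<close> for \<open>c = 1\<close>.  The branch that satisfies the two
  sign conditions for \<open>z\<close> close to the positive axis is
  \<open>v \<approx> - \<i> (z / (c (1 - c))) powr (1/2)\<close>, respectively
  \<open>v \<approx> exp (- \<i> \<pi> / 3) (z / \<mu>) powr (1/3)\<close>; then \<open>t_nu \<approx> - \<mu> v / z\<close>, and the imaginary part
  gives both asymptotic formulas.  The branch is made exact, and continuous up to the real axis, by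
  holomorphic inversion at \<open>0\<close> (\<open>root_branch\<close>), so that the boundary value of \<open>t_nu\<close> at a small
  \<open>x > 0\<close> is obtained by inserting the branch at \<open>x\<close> (\<open>boundary_value\<close>).

  As \<open>t\<close> is defined by its uniqueness, a solution that has been exhibited is \<open>t\<close> only once no other
  one exists (\<open>solution_unique\<close>).  This is a contraction argument: the imaginary parts of
  the equations for \<open>t\<close> and \<open>z t\<close> form a positive two-by-two linear system, which bounds a
  Lipschitz factor at every solution strictly by \<open>1\<close> (\<open>solution_contracts\<close>); by the Cauchy-Schwarz
  inequality the difference of two solutions is multiplied by at most the geometric mean of their
  factors.
\<close>

section \<open>Spectral theorem for Hermitian matrices\<close>

definition adjoint_matrix :: "complex^'n^'m \<Rightarrow> complex^'m^'n" where
  "adjoint_matrix A = (\<chi> i j. cnj (A $ j $ i))"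

definition cinner :: "complex^'m \<Rightarrow> complex^'m \<Rightarrow> complex" where
  "cinner u v = (\<Sum>i\<in>UNIV. cnj (u $ i) * v $ i)"

lemma inner_eq_Re_cinner: "u \<bullet> v = Re (cinner u v)"
  by (simp add: cinner_def inner_vec_def inner_complex_def)

lemma cinner_commute: "cinner u v = cnj (cinner v u)"
  by (simp add: cinner_def mult.commute)

lemma cinner_add_right: "cinner u (v + w) = cinner u v + cinner u w"
  by (simp add: cinner_def sum.distrib algebra_simps)

lemma cinner_scale_left: "cinner (k *s u) v = cnj k * cinner u v"
  by (simp add: cinner_def sum_distrib_left algebra_simps)

lemma cinner_scale_right: "cinner u (k *s v) = k * cinner u v"
  by (simp add: cinner_def sum_distrib_left algebra_simps)

lemma cinner_self: "cinner v v = of_real ((norm v)\<^sup>2)"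
proof -
  have "cinner v v = of_real (\<Sum>i\<in>UNIV. (cmod (v $ i))\<^sup>2)"
    by (simp add: cinner_def complex_norm_square mult.commute del: of_real_power)
  also have "(\<Sum>i\<in>UNIV. (cmod (v $ i))\<^sup>2) = (norm v)\<^sup>2"
    by (simp add: norm_vec_def L2_set_def sum_nonneg)
  finally show ?thesis .
qed

lemma quad_form_eq_cinner: "quad_form A v = cinner v (A *v v)"
  by (simp add: quad_form_def cinner_def)

lemma cinner_matrix_vector:
  assumes "hermitian A" shows "cinner u (A *v v) = cinner (A *v u) v"
proof -
  have A: "cnj (A $ j $ i) = A $ i $ j" for i j
    using assms unfolding hermitian_def by (metis vec_lambda_beta)
  have "cinner u (A *v v) = (\<Sum>i\<in>UNIV. \<Sum>j\<in>UNIV. cnj (u $ i) * A $ i $ j * v $ j)"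
    by (simp add: cinner_def matrix_vector_mult_def sum_distrib_left mult.assoc)
  also have "\<dots> = (\<Sum>j\<in>UNIV. \<Sum>i\<in>UNIV. cnj (u $ i) * A $ i $ j * v $ j)"
    by (rule sum.swap)
  also have "\<dots> = cinner (A *v u) v"
    by (simp add: cinner_def matrix_vector_mult_def sum_distrib_right sum_distrib_left A mult_ac)
  finally show ?thesis .
qed

text \<open>
  A maximum of the quadratic form on the unit sphere of an invariant subspace is an eigenvector:
  if \<open>q\<close> is the maximal value, \<open>q - A\<close> is positive semidefinite on the subspace and its form vanishes
  at the maximiser, which therefore lies in its kernel.  The maximum exists because the argument
  takes place in the underlying real Euclidean space, whose unit sphere is compact.
\<close>
lemma selfadjoint_max_eigenvector:
  fixes A :: "complex^'m^'m" and W :: "(complex^'m) set"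
  assumes herm: "hermitian A" and W: "subspace W" and nonzero: "\<exists>v\<in>W. v \<noteq> 0"
    and inv: "\<And>v. v \<in> W \<Longrightarrow> A *v v \<in> W"
  shows "\<exists>v\<in>W. \<exists>\<mu>::real. norm v = 1 \<and> A *v v = of_real \<mu> *s v"
proof -
  have sym: "u \<bullet> (A *v v) = (A *v u) \<bullet> v" for u v
    using cinner_matrix_vector[OF herm] by (simp add: inner_eq_Re_cinner)
  have lin: "linear (\<lambda>v. A *v v)"
  proof (rule linearI)
    show "A *v (u + w) = A *v u + A *v w" for u w
      by (rule matrix_vector_right_distrib)
    show "A *v (r *\<^sub>R w) = r *\<^sub>R (A *v w)" for r w
      by (simp add: vec_eq_iff matrix_vector_mult_def scaleR_sum_right)
  qed
  have real: "complex_of_real s *s v = s *\<^sub>R v" for s :: real and v :: "complex^'m"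
    by (simp add: vec_eq_iff, simp add: scaleR_conv_of_real)
  define q where "q v = v \<bullet> (A *v v)" for v
  obtain w where w: "w \<in> W" "w \<noteq> 0" using nonzero by blast
  define S where "S = W \<inter> sphere 0 1"
  have "compact S" unfolding S_def
    by (intro closed_Int_compact closed_subspace W compact_sphere)
  moreover have "(1 / norm w) *\<^sub>R w \<in> S"
    using w W by (simp add: S_def subspace_scale)
  moreover have "continuous_on S q" unfolding q_def
    by (intro continuous_intros linear_continuous_on_compose[OF continuous_on_id lin])
  ultimately obtain v where v: "v \<in> S" and vmax: "\<And>y. y \<in> S \<Longrightarrow> q y \<le> q v"
    using continuous_attains_sup[of S q] by blast
  define B where "B y = q v *\<^sub>R y - A *v y" for y
  have vW: "v \<in> W" and nv: "norm v = 1" using v by (auto simp: S_def)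
  have Bpos: "0 \<le> y \<bullet> B y" if "y \<in> W" for y
  proof (cases "y = 0")
    case False
    have "q ((1 / norm y) *\<^sub>R y) \<le> q v"
      using that False W by (intro vmax) (simp add: S_def subspace_scale)
    moreover have "q ((1 / norm y) *\<^sub>R y) = q y / (norm y)\<^sup>2"
      unfolding q_def linear_scale[OF lin] by (simp add: power2_eq_square)
    ultimately have "q y \<le> q v * (norm y)\<^sup>2"
      using False by (simp add: field_simps)
    then show ?thesis
      by (simp add: B_def q_def inner_diff_right power2_norm_eq_inner)
  qed (simp add: B_def)
  have Bv: "v \<bullet> B v = 0"
    using nv by (simp add: B_def q_def inner_diff_right flip: power2_norm_eq_inner)
  define y where "y = B v"
  have yW: "y \<in> W" unfolding y_def B_def
    by (intro subspace_diff subspace_scale W vW inv)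
  have "y = 0"
  proof (rule ccontr)
    assume "y \<noteq> 0"
    then have ypos: "0 < y \<bullet> y" by simp
    have expand: "(v + s *\<^sub>R y) \<bullet> B (v + s *\<^sub>R y) = 2 * s * (y \<bullet> y) + s\<^sup>2 * (y \<bullet> B y)" for s
    proof -
      have "B (v + s *\<^sub>R y) = y + s *\<^sub>R B y"
        by (simp add: y_def B_def linear_add[OF lin] linear_scale[OF lin] algebra_simps)
      moreover have "v \<bullet> B y = B v \<bullet> y"
        by (simp add: B_def inner_diff_right inner_diff_left sym)
      then have "v \<bullet> B y = y \<bullet> y" by (simp add: y_def)
      ultimately show ?thesis
        using Bv by (simp add: inner_add_left inner_add_right power2_eq_square
            distrib_left flip: y_def)
    qed
    define e where "e = y \<bullet> B y"
    have e: "0 \<le> e" using Bpos[OF yW] by (simp add: e_def)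
    \<comment> \<open>The form at \<open>v + s y\<close> has a nonzero term linear in \<open>s\<close> and vanishes at \<open>s = 0\<close>, so a small
       negative \<open>s\<close> makes it negative; this \<open>s\<close> is small enough.\<close>
    define s where "s = - (y \<bullet> y) / (e + 1)"
    have "0 \<le> 2 * s * (y \<bullet> y) + s\<^sup>2 * e"
      unfolding e_def expand[symmetric]
      by (intro Bpos subspace_add subspace_scale W vW yW)
    also have "\<dots> = - (y \<bullet> y)\<^sup>2 * (e + 2) / (e + 1)\<^sup>2"
      using e by (simp add: s_def power2_eq_square divide_simps) (simp add: algebra_simps)
    also have "\<dots> < 0"
      using e ypos by (simp add: divide_neg_pos mult_pos_pos)
    finally show False by simp
  qed
  then have "A *v v = of_real (q v) *s v"
    by (simp add: y_def B_def real)
  then show ?thesis using vW nv by blast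
qed

text \<open>
  The eigenvectors are found one at a time in the orthogonal complement of those already chosen,
  which is invariant because the matrix is Hermitian.
\<close>
lemma orthonormal_eigenvectors_exist:
  fixes A :: "complex^'m^'m"
  assumes herm: "hermitian A" and "n \<le> CARD('m)"
  shows "\<exists>S. finite S \<and> card S = n \<and> (\<forall>u\<in>S. \<forall>v\<in>S. cinner u v = (if u = v then 1 else 0))
           \<and> (\<forall>u\<in>S. \<exists>\<mu>::real. A *v u = of_real \<mu> *s u)"
  using assms(2)
proof (induction n)
  case 0
  then show ?case by (intro exI[of _ "{}"]) auto
next
  case (Suc n)
  then obtain S where S: "finite S" "card S = n"
    and orth: "\<forall>u\<in>S. \<forall>v\<in>S. cinner u v = (if u = v then 1 else 0)"
    and eig: "\<forall>u\<in>S. \<exists>\<mu>::real. A *v u = of_real \<mu> *s u" by auto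
  define W where "W = {v. \<forall>u\<in>S. cinner u v = 0}"
  have real: "complex_of_real s *s v = s *\<^sub>R v" for s :: real and v :: "complex^'m"
    by (simp add: vec_eq_iff, simp add: scaleR_conv_of_real)
  have "subspace W"
    unfolding subspace_def W_def
    by (auto simp: cinner_add_right cinner_scale_right simp flip: real) (simp add: cinner_def)
  moreover have "\<exists>v\<in>W. v \<noteq> 0"
  proof -
    \<comment> \<open>Complex orthogonality to \<open>S\<close> is real orthogonality to \<open>S\<close> and \<open>\<i> S\<close>, and the real
       dimension of the whole space is twice the complex one.\<close>
    let ?S = "S \<union> (\<lambda>u. \<i> *s u) ` S"
    have "dim ?S \<le> card ?S" using S by (intro dim_le_card') auto
    also have "\<dots> \<le> 2 * n"
      using card_Un_le[of S "(\<lambda>u. \<i> *s u) ` S"] card_image_le[OF S(1), of "\<lambda>u. \<i> *s u"] S(2) by linarith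
    also have "\<dots> < DIM(complex^'m)" using Suc.prems by simp
    finally obtain x where x: "x \<noteq> 0" and xo: "\<And>y. y \<in> span ?S \<Longrightarrow> orthogonal x y"
      using orthogonal_to_subspace_exists by blast
    have "cinner u x = 0" if "u \<in> S" for u
    proof (rule complex_eqI)
      have "orthogonal x u" "orthogonal x (\<i> *s u)" using that by (auto intro!: xo span_base)
      then have "u \<bullet> x = 0" "(\<i> *s u) \<bullet> x = 0" by (auto simp: orthogonal_def inner_commute)
      then show "Re (cinner u x) = Re 0" "Im (cinner u x) = Im 0"
        by (auto simp: inner_eq_Re_cinner cinner_scale_left)
    qed
    then show ?thesis using x by (auto simp: W_def)
  qed
  moreover have "A *v v \<in> W" if "v \<in> W" for v
    using that eig by (force simp: W_def cinner_matrix_vector[OF herm] cinner_scale_left)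
  ultimately obtain v and \<mu> :: real where v: "v \<in> W" "norm v = 1" "A *v v = of_real \<mu> *s v"
    using selfadjoint_max_eigenvector[OF herm] by blast
  have vv: "cinner v v = 1" using v by (simp add: cinner_self)
  have uv: "cinner u v = 0" "cinner v u = 0" if "u \<in> S" for u
    using v that cinner_commute[of v u] by (auto simp: W_def)
  have "v \<notin> S" using uv vv by force
  then show ?case using S orth eig v vv uv
    by (intro exI[of _ "insert v S"]) auto
qed

definition diagonal_matrix :: "('m \<Rightarrow> complex) \<Rightarrow> complex^'m^'m" where
  "diagonal_matrix d = (\<chi> i j. if i = j then d i else 0)"

definition conjugated_diagonal :: "complex^'m^'m \<Rightarrow> ('m \<Rightarrow> complex) \<Rightarrow> complex^'m^'m" where
  "conjugated_diagonal U d = U ** diagonal_matrix d ** adjoint_matrix U"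

theorem hermitian_diagonalizable:
  fixes A :: "complex^'m^'m"
  assumes herm: "hermitian A"
  obtains U and l :: "'m \<Rightarrow> real" where
    "adjoint_matrix U ** U = mat 1" "U ** adjoint_matrix U = mat 1"
    "A = conjugated_diagonal U (\<lambda>i. of_real (l i))"
    "\<And>i. norm (column i U) = 1" "\<And>i. A *v column i U = of_real (l i) *s column i U"
proof -
  obtain S where S: "finite S" "card S = CARD('m)"
    and orth: "\<forall>u\<in>S. \<forall>v\<in>S. cinner u v = (if u = v then 1 else 0)"
    and eig: "\<forall>u\<in>S. \<exists>\<mu>::real. A *v u = of_real \<mu> *s u"
    using orthonormal_eigenvectors_exist[OF herm order_refl] by blast
  obtain f where f: "bij_betw f (UNIV :: 'm set) S"
    using S by (metis finite_same_card_bij finite_class.finite_UNIV)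
  have fS: "f i \<in> S" for i using f by (auto simp: bij_betw_def)
  have finj: "f i = f j \<longleftrightarrow> i = j" for i j using f by (auto simp: bij_betw_def inj_on_def)
  have "\<exists>\<mu>::real. A *v f i = of_real \<mu> *s f i" for i
    using eig fS by blast
  then have "\<exists>l. \<forall>i. A *v f i = of_real (l i :: real) *s f i"
    by (intro choice) blast
  then obtain l where l: "\<And>i. A *v f i = of_real (l i :: real) *s f i" by blast
  define U where "U = (\<chi> i j. f j $ i)"
  have col: "column i U = f i" for i by (simp add: column_def U_def vec_eq_iff)
  have "adjoint_matrix U ** U = (\<chi> i j. cinner (f i) (f j))"
    by (simp add: adjoint_matrix_def matrix_matrix_mult_def U_def cinner_def)
  also have "\<dots> = mat 1"
    using orth fS finj by (simp add: mat_def vec_eq_iff)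
  finally have 1: "adjoint_matrix U ** U = mat 1" .
  then have 2: "U ** adjoint_matrix U = mat 1"
    using matrix_left_right_inverse by blast
  have "A ** U = U ** diagonal_matrix (\<lambda>i. of_real (l i))"
  proof -
    have "(A ** U) $ i $ j = (A *v f j) $ i" for i j
      by (simp add: matrix_matrix_mult_def matrix_vector_mult_def U_def)
    moreover have "(U ** diagonal_matrix (\<lambda>i. of_real (l i))) $ i $ j = of_real (l j) * f j $ i" for i j
      by (simp add: matrix_matrix_mult_def diagonal_matrix_def U_def if_distrib[of "\<lambda>x. _ * x"]
           mult.commute cong: if_cong)
    ultimately show ?thesis by (simp add: vec_eq_iff l)
  qed
  then have "A = U ** diagonal_matrix (\<lambda>i. of_real (l i)) ** adjoint_matrix U"
    using 2 by (metis matrix_mul_assoc matrix_mul_rid)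
  moreover have "norm (f i) = 1" for i
  proof -
    have "(norm (f i))\<^sup>2 = Re (cinner (f i) (f i))" by (simp add: cinner_self)
    also have "\<dots> = 1" using orth fS by simp
    finally show ?thesis by (simp add: power2_eq_1_iff) (metis norm_ge_zero neg_0_le_iff_le not_one_le_zero)
  qed
  ultimately show thesis using that[of U l] 1 2 col l by (simp add: conjugated_diagonal_def)
qed

lemma diagonal_matrix_mult:
  "diagonal_matrix d ** diagonal_matrix e = diagonal_matrix (\<lambda>i. d i * e i)"
proof -
  have "(\<Sum>k\<in>UNIV. (if i = k then d i else 0) * (if k = j then e k else 0))
      = (if i = j then d i * e i else 0)" for i j
  proof -
    have "(if i = k then d i else 0) * (if k = j then e k else 0)
        = (if i = k then (if i = j then d i * e i else 0) else 0)" for k by simp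
    then show ?thesis by simp
  qed
  then show ?thesis
    by (simp add: diagonal_matrix_def matrix_matrix_mult_def vec_eq_iff)
qed

lemma mat_eq_diagonal: "mat k = diagonal_matrix (\<lambda>i. k)"
  by (simp add: mat_def diagonal_matrix_def)

lemma mat_central: fixes A :: "complex^'m^'m" shows "mat k ** A = A ** mat k"
proof -
  have "(\<Sum>l\<in>UNIV. (if i = l then k else 0) * A $ l $ j) = k * A $ i $ j" for i j
    by (simp add: if_distribR if_distrib[of "\<lambda>x. x * _"] cong: if_cong)
  moreover have "(\<Sum>l\<in>UNIV. A $ i $ l * (if l = j then k else 0)) = k * A $ i $ j" for i j
    by (simp add: if_distrib[of "\<lambda>x. _ * x"] mult.commute cong: if_cong)
  ultimately show ?thesis
    by (simp add: mat_def matrix_matrix_mult_def vec_eq_iff)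
qed

lemma conjugated_diagonal_mult:
  assumes "adjoint_matrix U ** U = mat 1"
  shows "conjugated_diagonal U d ** conjugated_diagonal U e = conjugated_diagonal U (\<lambda>i. d i * e i)"
proof -
  have "conjugated_diagonal U d ** conjugated_diagonal U e
      = U ** diagonal_matrix d ** (adjoint_matrix U ** U) ** diagonal_matrix e ** adjoint_matrix U"
    by (simp add: conjugated_diagonal_def matrix_mul_assoc)
  then show ?thesis
    by (simp add: assms conjugated_diagonal_def flip: diagonal_matrix_mult)
       (simp add: matrix_mul_assoc)
qed

lemma mat_eq_conjugated_diagonal:
  assumes "U ** adjoint_matrix U = mat 1"
  shows "mat k = conjugated_diagonal U (\<lambda>i. k)"
proof -
  have "conjugated_diagonal U (\<lambda>i. k) = U ** mat k ** adjoint_matrix U"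
    by (simp only: conjugated_diagonal_def mat_eq_diagonal)
  also have "\<dots> = mat k ** (U ** adjoint_matrix U)"
    by (simp only: matrix_mul_assoc mat_central[of k U])
  finally show ?thesis by (simp only: assms matrix_mul_rid)
qed

lemma conjugated_diagonal_add:
  "conjugated_diagonal U d + conjugated_diagonal U e = conjugated_diagonal U (\<lambda>i. d i + e i)"
proof -
  have "diagonal_matrix (\<lambda>i. d i + e i) = diagonal_matrix d + diagonal_matrix e"
    by (simp add: diagonal_matrix_def vec_eq_iff)
  then show ?thesis
    by (simp add: conjugated_diagonal_def matrix_add_ldistrib)
       (simp add: matrix_matrix_mult_def vec_eq_iff sum.distrib distrib_right)
qed

lemma matrix_inv_conjugated_diagonal:
  assumes "adjoint_matrix U ** U = mat 1" "U ** adjoint_matrix U = mat 1" "\<And>i. d i \<noteq> 0"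
  shows "matrix_inv (conjugated_diagonal U d) = conjugated_diagonal U (\<lambda>i. 1 / d i)"
proof -
  let ?A = "conjugated_diagonal U d" and ?B = "conjugated_diagonal U (\<lambda>i. 1 / d i)"
  have AB: "?A ** ?B = mat 1" "?B ** ?A = mat 1"
    unfolding conjugated_diagonal_mult[OF assms(1)] mat_eq_conjugated_diagonal[OF assms(2), of 1]
    using assms(3) by simp_all
  then have inv: "?A ** matrix_inv ?A = mat 1 \<and> matrix_inv ?A ** ?A = mat 1"
    using someI[of "\<lambda>X. ?A ** X = mat 1 \<and> X ** ?A = mat 1" ?B] by (simp add: matrix_inv_def)
  have "matrix_inv ?A = matrix_inv ?A ** (?A ** ?B)"
    by (simp only: AB matrix_mul_rid)
  also have "\<dots> = ?B"
    by (simp only: matrix_mul_assoc inv matrix_mul_lid)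
  finally show ?thesis .
qed

lemma trace_conjugated_diagonal:
  assumes "adjoint_matrix U ** U = mat 1"
  shows "trace (conjugated_diagonal U d) = (\<Sum>i\<in>UNIV. d i)"
proof -
  have "trace (conjugated_diagonal U d) = trace (adjoint_matrix U ** (U ** diagonal_matrix d))"
    unfolding conjugated_diagonal_def by (rule trace_mul_sym)
  also have "\<dots> = trace (diagonal_matrix d)"
    by (simp add: matrix_mul_assoc assms)
  finally show ?thesis by (simp add: trace_def diagonal_matrix_def)
qed

section \<open>Averages over the spectrum\<close>

definition mean :: "('m::finite \<Rightarrow> 'a::real_normed_field) \<Rightarrow> 'a" where
  "mean f = (\<Sum>i\<in>UNIV. f i) / of_nat CARD('m)"

lemma mean_diff: "mean (\<lambda>i. f i - g i) = mean f - mean g"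
  by (simp add: mean_def sum_subtractf diff_divide_distrib)

lemma mean_cmult: "mean (\<lambda>i. k * f i) = k * mean f"
  by (simp add: mean_def sum_distrib_left)

lemma mean_const [simp]: "mean (\<lambda>i::'m::finite. k) = (k::'a::real_normed_field)"
  by (simp add: mean_def)

lemma Im_mean: "Im (mean f) = mean (\<lambda>i. Im (f i))"
  by (simp add: mean_def)

lemma of_real_mean: "of_real (mean f) = mean (\<lambda>i. of_real (f i))"
  by (simp add: mean_def)

lemma norm_mean: "norm (mean f) \<le> mean (\<lambda>i. norm (f i))"
  by (simp add: mean_def norm_divide sum_norm_le divide_right_mono)

lemma mean_pos: "(\<And>i. 0 < (f i :: real)) \<Longrightarrow> 0 < mean f"
  by (simp add: mean_def sum_pos)

lemma mean_Cauchy_Schwarz: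
  fixes f g :: "'m::finite \<Rightarrow> real"
  shows "(mean (\<lambda>i. f i * g i))\<^sup>2 \<le> mean (\<lambda>i. (f i)\<^sup>2) * mean (\<lambda>i. (g i)\<^sup>2)"
proof -
  have "(\<Sum>i\<in>UNIV. f i * g i)\<^sup>2 \<le> (\<Sum>i\<in>UNIV. (f i)\<^sup>2) * (\<Sum>i\<in>UNIV. (g i)\<^sup>2)"
    by (rule Cauchy_Schwarz_ineq_sum)
  then show ?thesis
    by (simp add: mean_def power2_eq_square divide_right_mono)
qed

lemma Im_divide_real_pos:
  assumes "0 < r" "Im w < 0" shows "0 < Im (of_real r / w)"
  using assms by (auto simp: Im_divide power2_eq_square[symmetric] intro!: divide_pos_pos mult_neg_neg
     add_nonneg_pos simp: mult_pos_neg sum_power2_gt_zero_iff divide_neg_pos zero_less_divide_iff)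

lemma Im_inverse_neg: "0 < Im w \<Longrightarrow> Im (inverse w) < 0"
  by (auto simp: Im_divide inverse_complex.sel zero_less_mult_iff sum_power2_gt_zero_iff divide_neg_pos)

lemma Im_inverse: "Im (inverse w) = - Im w / (cmod w)\<^sup>2"
  by (simp add: cmod_power2)

definition has_eigenvalues :: "complex^'m^'m \<Rightarrow> ('m \<Rightarrow> real) \<Rightarrow> bool" where
  "has_eigenvalues A l \<longleftrightarrow> (\<exists>U. adjoint_matrix U ** U = mat 1 \<and> U ** adjoint_matrix U = mat 1
      \<and> A = conjugated_diagonal U (\<lambda>i. of_real (l i)))"

lemma hermitian_has_positive_eigenvalues:
  assumes "hermitian A" "0 < a" "loewner_le (mat (of_real a)) A"
  obtains l where "has_eigenvalues A l" "\<And>i. 0 < l i"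
proof -
  obtain U l where U: "adjoint_matrix U ** U = mat 1" "U ** adjoint_matrix U = mat 1"
    and A: "A = conjugated_diagonal U (\<lambda>i. of_real (l i))"
    and eig: "\<And>i. norm (column i U) = 1" "\<And>i. A *v column i U = of_real (l i) *s column i U"
    by (rule hermitian_diagonalizable[OF assms(1)]) (rule that, assumption+)
  have "0 < l i" for i
  proof -
    let ?u = "column i U"
    have "mat (of_real a) *v ?u = of_real a *s ?u"
      by (simp add: vec_eq_iff matrix_vector_mult_def mat_def if_distrib if_distribR cong: if_cong)
    then have shifted: "(A - mat (of_real a)) *v ?u = of_real (l i - a) *s ?u"
      by (simp add: matrix_vector_mult_diff_rdistrib eig vec_eq_iff algebra_simps)
    have "quad_form (A - mat (of_real a)) ?u = of_real (l i - a)"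
      unfolding quad_form_eq_cinner shifted cinner_scale_right cinner_self eig(1) by simp
    moreover have "0 \<le> Re (quad_form (A - mat (of_real a)) ?u)"
      using assms(3) by (simp add: loewner_le_def psd_def)
    ultimately show ?thesis using \<open>0 < a\<close> by simp
  qed
  then show thesis using that[of l] U A by (auto simp: has_eigenvalues_def)
qed

text \<open>
  Every trace in the definitions of \<open>t\<close> and \<open>t_nu\<close> is of one of these two forms; from here on
  only the eigenvalues matter.
\<close>
lemma ntrace_functional_calculus:
  fixes A :: "complex^'m^'m"
  assumes "has_eigenvalues A l" "\<And>i. p + q * of_real (l i) \<noteq> 0"
  shows "ntrace (A ** matrix_inv (mat p + mat q ** A)) = mean (\<lambda>i. of_real (l i) / (p + q * of_real (l i)))"
    and "ntrace (matrix_inv (mat p + mat q ** A)) = mean (\<lambda>i. 1 / (p + q * of_real (l i)))"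
proof -
  obtain U where U: "adjoint_matrix U ** U = mat 1" "U ** adjoint_matrix U = mat 1"
    and A: "A = conjugated_diagonal U (\<lambda>i. of_real (l i))"
    using assms(1) by (auto simp: has_eigenvalues_def)
  have inv: "matrix_inv (mat p + mat q ** A) = conjugated_diagonal U (\<lambda>i. 1 / (p + q * of_real (l i)))"
    unfolding A mat_eq_conjugated_diagonal[OF U(2)] conjugated_diagonal_mult[OF U(1)] conjugated_diagonal_add
    by (rule matrix_inv_conjugated_diagonal[OF U assms(2)])
  show "ntrace (matrix_inv (mat p + mat q ** A)) = mean (\<lambda>i. 1 / (p + q * of_real (l i)))"
    unfolding inv ntrace_def trace_conjugated_diagonal[OF U(1)] mean_def ..
  show "ntrace (A ** matrix_inv (mat p + mat q ** A)) = mean (\<lambda>i. of_real (l i) / (p + q * of_real (l i)))"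
    unfolding inv unfolding A conjugated_diagonal_mult[OF U(1)] ntrace_def trace_conjugated_diagonal[OF U(1)] mean_def
    by simp
qed

section \<open>Uniqueness of the solution of the scalar equation\<close>

locale fixed_point_equation =
  fixes c :: real and l :: "'m::finite \<Rightarrow> real"
  assumes c_pos: "0 < c" and l_pos: "\<And>i. 0 < l i"
begin

definition solves :: "complex \<Rightarrow> complex \<Rightarrow> bool" where
  "solves z t \<longleftrightarrow> 0 < Im t \<and> 0 < Im (z * t)
     \<and> t = mean (\<lambda>i. of_real (l i) / (- z - coeff_R c z t * of_real (l i)))"

text \<open>
  The reciprocal of the coefficient separates \<open>z t\<close> from \<open>t\<close>.  The denominator in \<open>coeff_R\<close> is
  \<open>1 - (c t) (c z t)\<close>, and two points of the upper half plane never have product \<open>1\<close>, since the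
  reciprocal of one lies in the lower half plane.
\<close>
lemma coeff_R_inverse:
  fixes z t :: complex
  assumes t: "0 < Im t" "0 < Im (z * t)"
  shows "coeff_R c z t \<noteq> 0"
    and "inverse (coeff_R c z t) = 1 / (z * c * t) - c * t"
    and "z * inverse (coeff_R c z t) = 1 / (c * t) - z * c * t"
proof -
  define x where "x = of_real c * t"
  define y where "y = z * of_real c * t"
  have y: "y = c * (z * t)" by (simp add: y_def)
  have xy: "0 < Im x" "0 < Im y" using t c_pos unfolding x_def y by simp_all
  have "x * y \<noteq> 1"
  proof
    assume "x * y = 1"
    then have "inverse x = y" by (metis inverse_unique)
    then show False using Im_inverse_neg xy by fastforce
  qed
  moreover have eq: "coeff_R c z t = y / (1 - x * y)"
    by (simp add: coeff_R_def x_def y_def power2_eq_square mult_ac)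
  moreover have "y \<noteq> 0" "x \<noteq> 0" using xy by auto
  ultimately have inv: "coeff_R c z t \<noteq> 0" "inverse (coeff_R c z t) = 1 / y - x"
    unfolding eq by (simp_all add: diff_divide_distrib)
  then show "coeff_R c z t \<noteq> 0" and "inverse (coeff_R c z t) = 1 / (z * c * t) - c * t"
    by (simp_all add: x_def y_def)
  show "z * inverse (coeff_R c z t) = 1 / (c * t) - z * c * t"
    using \<open>y \<noteq> 0\<close> unfolding inv by (simp add: x_def y_def right_diff_distrib)
qed

text \<open>
  Expressing the imaginary parts of \<open>k\<close> and \<open>k / z\<close> linearly in those of \<open>t\<close> and \<open>z t\<close> is what turns
  the scalar equation into the linear system of \<open>solution_contracts\<close>.
\<close>
lemma Im_coeff_R:
  fixes z t :: complex
  assumes t: "0 < Im t" "0 < Im (z * t)"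
  shows "0 < Im (coeff_R c z t)" 
    and "Im (coeff_R c z t) = (cmod (coeff_R c z t))\<^sup>2 * (c * Im t + Im (z * t) / (c * (cmod (z * t))\<^sup>2))"
    and "Im (coeff_R c z t / z) = (cmod (coeff_R c z t))\<^sup>2 / (cmod z)\<^sup>2 * (c * Im (z * t) + Im t / (c * (cmod t)\<^sup>2))"
proof -
  let ?k = "coeff_R c z t"
  have z: "z \<noteq> 0" using t by auto
  have inv: "Im (1 / (of_real c * w)) = - Im w / (c * (cmod w)\<^sup>2)" for w
  proof -
    have "Im (1 / (of_real c * w)) = Im (inverse w) / c"
      using c_pos by (simp add: divide_inverse Im_inverse flip: of_real_inverse)
    then show ?thesis by (simp only: Im_inverse) (simp add: mult.commute)
  qed
  have imc: "Im (of_real c * w) = c * Im w" for w by simp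
  note k = coeff_R_inverse[OF t]
  have k1: "inverse ?k = 1 / (of_real c * (z * t)) - of_real c * t" 
    using k(2) by (simp add: mult_ac)
  have k2: "inverse (?k / z) = 1 / (of_real c * t) - of_real c * (z * t)" 
    using k(3) by (simp add: field_simps)
  have "Im ?k = - (cmod ?k)\<^sup>2 * Im (inverse ?k)"
    using k(1) unfolding Im_inverse by simp
  then show 1: "Im ?k = (cmod ?k)\<^sup>2 * (c * Im t + Im (z * t) / (c * (cmod (z * t))\<^sup>2))"
    unfolding k1 by (simp only: minus_complex.sel inv) (simp add: algebra_simps)
  have "Im (?k / z) = - (cmod (?k / z))\<^sup>2 * Im (inverse (?k / z))"
    using k(1) z unfolding Im_inverse by simp
  then show "Im (?k / z) = (cmod ?k)\<^sup>2 / (cmod z)\<^sup>2 * (c * Im (z * t) + Im t / (c * (cmod t)\<^sup>2))"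
    unfolding k2 minus_complex.sel inv norm_divide power_divide
    by (simp add: right_diff_distrib distrib_left imc del: times_complex.sel)
  show "0 < Im ?k" unfolding 1 using c_pos t k(1)
    by (intro mult_pos_pos add_pos_nonneg) auto
qed

text \<open>
  A bound for the modulus of the derivative of \<open>mean (l / (- z - k l))\<close> with respect to \<open>k\<close>.
\<close>
definition resolvent_mass :: "complex \<Rightarrow> complex \<Rightarrow> real" where
  "resolvent_mass z k = mean (\<lambda>i. (cmod (of_real (l i) / (- z - k * of_real (l i))))\<^sup>2)"

text \<open>
  Write \<open>a\<close> and \<open>b\<close> for the imaginary parts of \<open>t\<close> and \<open>z t\<close>, and \<open>P\<close> for \<open>\<bar>k\<bar>\<^sup>2\<close> times the resolvent
  mass.  Taking imaginary parts of the equations for \<open>t\<close> and \<open>z t\<close> gives \<open>P (c a + p b) < a\<close> and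
  \<open>P (q a + c b) = b\<close> with positive \<open>p\<close>, \<open>q\<close>, the strict inequality coming from the term \<open>Im z\<close> of the
  resolvent.  A nonnegative matrix that maps a positive vector below itself has spectral radius at
  most \<open>1\<close>; here the strict bound on the spectral radius \<open>P (c + sqrt (p q))\<close> follows by multiplying
  the two relations.
\<close>
lemma solution_contracts:
  assumes z: "0 < Im z" and sol: "solves z t"
  defines "k \<equiv> coeff_R c z t"
  shows "(cmod k)\<^sup>2 * resolvent_mass z k * (c + 1 / (c * cmod z * (cmod t)\<^sup>2)) < 1"
proof -
  have t: "0 < Im t" "0 < Im (z * t)" 
    and eq: "t = mean (\<lambda>i. of_real (l i) / (- z - k * of_real (l i)))"
    using sol by (simp_all add: solves_def k_def)
  have nz: "z \<noteq> 0" "t \<noteq> 0" using t by auto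
  have ki: "0 < Im k" using Im_coeff_R[OF t] by (simp add: k_def)
  define S where "S = resolvent_mass z k"
  define P where "P = (cmod k)\<^sup>2 * S"
  define a b where "a = Im t" and "b = Im (z * t)"
  have den: "- z - k * of_real (l i) \<noteq> 0" for i
    using z ki l_pos[of i] by (auto simp: complex_eq_iff) (smt (verit) mult_pos_pos)
  have S: "0 < S" unfolding S_def resolvent_mass_def
    using den l_pos by (intro mean_pos) (simp add: less_imp_neq[THEN not_sym])
  have Im_term: "Im (of_real x / (- w)) = x * Im w / (cmod w)\<^sup>2" for x w
    by (simp add: Im_divide cmod_power2)
  have "Im k * S < a"
  proof -
    have "Im k * S = mean (\<lambda>i. Im k * (cmod (of_real (l i) / (- z - k * of_real (l i))))\<^sup>2)"
      unfolding S_def resolvent_mass_def mean_cmult ..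
    also have "0 < a - \<dots>"
      unfolding a_def eq Im_mean mean_diff[symmetric]
    proof (rule mean_pos)
      fix i
      have "Im (of_real (l i) / (- z - k * of_real (l i)))
            = l i * (Im z + Im k * l i) / (cmod (z + k * of_real (l i)))\<^sup>2"
        using Im_term[of "l i" "z + k * of_real (l i)"] by simp
      moreover have "cmod (- z - k * of_real (l i)) = cmod (z + k * of_real (l i))"
        by (metis add_uminus_conv_diff minus_add_distrib norm_minus_cancel)
      moreover have "z + k * of_real (l i) \<noteq> 0" using den[of i] by (simp add: algebra_simps add_eq_0_iff)
      ultimately show "0 < Im (of_real (l i) / (- z - k * of_real (l i)))
          - Im k * (cmod (of_real (l i) / (- z - k * of_real (l i))))\<^sup>2"
        using l_pos[of i] z
        by (simp add: norm_divide power_divide divide_simps) (simp add: algebra_simps power2_eq_square)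
    qed
    finally show ?thesis by simp
  qed
  then have A: "P * (c * a + b / (c * (cmod (z * t))\<^sup>2)) < a"
    using Im_coeff_R(2)[OF t] by (simp add: P_def k_def a_def b_def mult_ac)
  have "b = Im (k / z) * (cmod z)\<^sup>2 * S"
  proof -
    have "z * t = mean (\<lambda>i. z * (of_real (l i) / (- z - k * of_real (l i))))"
      unfolding mean_cmult eq[symmetric] ..
    then have "b = mean (\<lambda>i. Im (z * (of_real (l i) / (- z - k * of_real (l i)))))"
      unfolding b_def by (metis Im_mean)
    also have "\<dots> = mean (\<lambda>i. Im (k / z) * (cmod z)\<^sup>2 * (cmod (of_real (l i) / (- z - k * of_real (l i))))\<^sup>2)"
    proof (rule arg_cong[where f = mean], rule ext)
      fix i
      define w where "w = 1 + (k / z) * of_real (l i)"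
      have Im_w: "Im w = Im (k / z) * l i" by (simp add: w_def del: times_divide_eq_left)
      have fac: "- z - k * of_real (l i) = z * (- w)"
        using nz by (simp add: w_def field_simps)
      have w: "w \<noteq> 0" using den[of i] unfolding fac by auto
      have "z * (of_real (l i) / (- z - k * of_real (l i))) = of_real (l i) / (- w)"
        unfolding fac using nz w by (simp add: divide_simps)
      then have "Im (z * (of_real (l i) / (- z - k * of_real (l i)))) = l i * Im w / (cmod w)\<^sup>2"
        by (simp only: Im_term)
      also have "\<dots> = Im (k / z) * (cmod z)\<^sup>2 * (cmod (of_real (l i) / (- z - k * of_real (l i))))\<^sup>2"
        unfolding fac norm_divide norm_mult norm_minus_cancel Im_w
        using nz w l_pos[of i]
        by (simp add: power_divide power_mult_distrib divide_simps del: Im_divide) (simp add: power2_eq_square)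
      finally show "Im (z * (of_real (l i) / (- z - k * of_real (l i)))) = \<dots>" .
    qed
    also have "\<dots> = Im (k / z) * (cmod z)\<^sup>2 * S"
      unfolding S_def resolvent_mass_def mean_cmult ..
    finally show ?thesis .
  qed
  then have B: "b = P * (c * b + a / (c * (cmod t)\<^sup>2))"
    using Im_coeff_R(3)[OF t] nz by (simp add: P_def k_def a_def b_def mult_ac)
  define p q where "p = 1 / (c * (cmod (z * t))\<^sup>2)" and "q = 1 / (c * (cmod t)\<^sup>2)"
  have P: "0 < P" using S ki by (auto simp: P_def intro!: mult_pos_pos)
  have pq: "0 < p" "0 < q" using c_pos nz by (simp_all add: p_def q_def)
  have ab: "0 < a" "0 < b" using t by (simp_all add: a_def b_def)
  have A': "P * p * b < (1 - P * c) * a" using A by (simp add: p_def algebra_simps)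
  have B': "P * q * a = (1 - P * c) * b" using B by (simp add: q_def algebra_simps)
  have pos: "0 < 1 - P * c" using B' ab P pq by (metis mult_pos_pos zero_less_mult_pos2)
  have "(P * p * b) * (P * q * a) < (1 - P * c) * a * ((1 - P * c) * b)"
    using A' B' ab P pq by (metis mult_pos_pos mult_strict_right_mono)
  then have "(P\<^sup>2 * (p * q)) * (a * b) < (1 - P * c)\<^sup>2 * (a * b)"
    by (simp add: power2_eq_square mult_ac)
  then have "P\<^sup>2 * (p * q) < (1 - P * c)\<^sup>2" using ab by simp
  moreover have "p * q = (1 / (c * cmod z * (cmod t)\<^sup>2))\<^sup>2"
    by (simp add: p_def q_def norm_mult power2_eq_square)
  ultimately have "(P * (1 / (c * cmod z * (cmod t)\<^sup>2)))\<^sup>2 < (1 - P * c)\<^sup>2"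
    by (simp only: power_mult_distrib)
  then have "P * (1 / (c * cmod z * (cmod t)\<^sup>2)) < 1 - P * c"
    using pos by (rule power2_less_imp_less[OF _ less_imp_le])
  then show ?thesis by (simp add: P_def S_def algebra_simps)
qed

text \<open>
  Subtracting the equations of two solutions and factoring out their difference leaves an expression
  of modulus \<open>1\<close>.  Cauchy-Schwarz, applied to the average and to the two-term factor
  \<open>c + 1 / (z c t1 t2)\<close>, bounds that modulus by the geometric mean of the two quantities that
  \<open>solution_contracts\<close> bounds by \<open>1\<close>.
\<close>
lemma solution_unique:
  assumes z: "0 < Im z" and sol1: "solves z t1" and sol2: "solves z t2"
  shows "t1 = t2"
proof (rule ccontr)
  assume neq: "t1 \<noteq> t2"
  define k1 k2 where "k1 = coeff_R c z t1" and "k2 = coeff_R c z t2"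
  have t1: "0 < Im t1" "0 < Im (z * t1)" and t2: "0 < Im t2" "0 < Im (z * t2)"
    using sol1 sol2 by (simp_all add: solves_def)
  have nz: "z \<noteq> 0" "t1 \<noteq> 0" "t2 \<noteq> 0" using t1 t2 by auto
  have k0: "k1 \<noteq> 0" "k2 \<noteq> 0" using coeff_R_inverse(1) t1 t2 by (simp_all add: k1_def k2_def)
  define d1 d2 where "d1 i = of_real (l i) / (- z - k1 * of_real (l i))"
    and "d2 i = of_real (l i) / (- z - k2 * of_real (l i))" for i
  have den: "- z - k1 * of_real (l i) \<noteq> 0" "- z - k2 * of_real (l i) \<noteq> 0" for i
    using z Im_coeff_R(1)[OF t1] Im_coeff_R(1)[OF t2] l_pos[of i]
    by (auto simp: complex_eq_iff k1_def k2_def) (smt (verit) mult_pos_pos)+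
  have kd: "k1 - k2 = (t1 - t2) * (k1 * k2 * (c + 1 / (z * c * t1 * t2)))"
  proof -
    have "k1 - k2 = k1 * k2 * (inverse k2 - inverse k1)"
      using k0 by (simp add: field_simps)
    also have "inverse k2 - inverse k1 = (t1 - t2) * (c + 1 / (z * c * t1 * t2))"
      unfolding k1_def k2_def coeff_R_inverse(2)[OF t1] coeff_R_inverse(2)[OF t2]
      using nz c_pos by (simp add: divide_simps) (simp add: algebra_simps)
    finally show ?thesis by (simp add: mult_ac)
  qed
  have "t1 - t2 = mean (\<lambda>i. d1 i - d2 i)"
    using sol1 sol2 by (simp add: solves_def k1_def k2_def mean_diff d1_def d2_def)
  also have "\<dots> = mean (\<lambda>i. (k1 - k2) * (d1 i * d2 i))"
    using den by (intro arg_cong[where f = mean] ext) (simp add: d1_def d2_def divide_simps, simp add: algebra_simps)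
  also have "\<dots> = (k1 - k2) * mean (\<lambda>i. d1 i * d2 i)" by (rule mean_cmult)
  finally have "1 = k1 * k2 * (c + 1 / (z * c * t1 * t2)) * mean (\<lambda>i. d1 i * d2 i)"
    using neq unfolding kd by (simp add: mult.assoc)
  then have "1 = cmod (k1 * k2 * (c + 1 / (z * c * t1 * t2)) * mean (\<lambda>i. d1 i * d2 i))"
    by (metis norm_one)
  also have "\<dots> \<le> cmod k1 * cmod k2 * (c + 1 / (cmod z * c * cmod t1 * cmod t2)) * mean (\<lambda>i. cmod (d1 i) * cmod (d2 i))"
  proof -
    have "cmod (c + 1 / (z * c * t1 * t2)) \<le> c + 1 / (cmod z * c * cmod t1 * cmod t2)"
      by (rule order_trans[OF norm_triangle_ineq]) (use c_pos in \<open>simp add: norm_mult norm_divide\<close>)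
    moreover have "cmod (mean (\<lambda>i. d1 i * d2 i)) \<le> mean (\<lambda>i. cmod (d1 i) * cmod (d2 i))"
      using norm_mean[of "\<lambda>i. d1 i * d2 i"] by (simp add: norm_mult)
    ultimately show ?thesis unfolding norm_mult using c_pos
      by (intro mult_mono mult_nonneg_nonneg add_nonneg_nonneg) auto
  qed
  finally have one_le: "1 \<le> \<dots>" .
  define S1 S2 where "S1 = resolvent_mass z k1" and "S2 = resolvent_mass z k2"
  define C where "C = mean (\<lambda>i. cmod (d1 i) * cmod (d2 i))"
  have C: "C\<^sup>2 \<le> S1 * S2"
    unfolding C_def S1_def S2_def resolvent_mass_def d1_def d2_def by (rule mean_Cauchy_Schwarz)
  define x1 x2 where "x1 = 1 / (sqrt (cmod z) * cmod t1)" and "x2 = 1 / (sqrt (cmod z) * cmod t2)"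
  have xx: "x1\<^sup>2 = 1 / (cmod z * (cmod t1)\<^sup>2)" "x2\<^sup>2 = 1 / (cmod z * (cmod t2)\<^sup>2)"
     "x1 * x2 = 1 / (cmod z * cmod t1 * cmod t2)"
    by (simp_all add: x1_def x2_def power_mult_distrib power_divide)
  have e1: "(cmod k1)\<^sup>2 * S1 * (c + x1\<^sup>2 / c) < 1"
    using solution_contracts[OF z sol1] by (simp add: xx S1_def k1_def mult_ac)
  have e2: "(cmod k2)\<^sup>2 * S2 * (c + x2\<^sup>2 / c) < 1"
    using solution_contracts[OF z sol2] by (simp add: xx S2_def k2_def mult_ac)
  have "1 \<le> cmod k1 * cmod k2 * (c + x1 * x2 / c) * C"
    using one_le by (simp add: xx C_def mult_ac)
  then have "1 \<le> (cmod k1 * cmod k2 * (c + x1 * x2 / c) * C)\<^sup>2"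
    by (simp add: one_le_power)
  also have "\<dots> = (cmod k1)\<^sup>2 * (cmod k2)\<^sup>2 * (c + x1 * x2 / c)\<^sup>2 * C\<^sup>2"
    by (simp add: power_mult_distrib)
  also have "\<dots> \<le> (cmod k1)\<^sup>2 * (cmod k2)\<^sup>2 * ((c + x1\<^sup>2 / c) * (c + x2\<^sup>2 / c)) * (S1 * S2)"
  proof -
    have "(c + x1\<^sup>2 / c) * (c + x2\<^sup>2 / c) - (c + x1 * x2 / c)\<^sup>2 = (x1 - x2)\<^sup>2"
      using c_pos by (simp add: power2_eq_square field_simps)
    then have "(c + x1 * x2 / c)\<^sup>2 \<le> (c + x1\<^sup>2 / c) * (c + x2\<^sup>2 / c)"
      by (metis diff_ge_0_iff_ge zero_le_power2)
    then show ?thesis using C c_pos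
      by (intro mult_mono mult_nonneg_nonneg add_nonneg_nonneg) auto
  qed
  also have "\<dots> = ((cmod k1)\<^sup>2 * S1 * (c + x1\<^sup>2 / c)) * ((cmod k2)\<^sup>2 * S2 * (c + x2\<^sup>2 / c))"
    by (simp add: mult_ac)
  also have "\<dots> < 1"
  proof -
    have "0 \<le> (cmod k2)\<^sup>2 * S2 * (c + x2\<^sup>2 / c)"
      unfolding S2_def resolvent_mass_def mean_def using c_pos
      by (intro mult_nonneg_nonneg add_nonneg_nonneg divide_nonneg_nonneg sum_nonneg) auto
    then show ?thesis using e1 e2
      by (smt (verit, best) mult_left_le_one_le mult_nonneg_nonneg mult_right_mono)
  qed
  finally show False by simp
qed


text \<open>
  On the required domain the matrix to be inverted has no zero eigenvalue, since all its eigenvalues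
  lie in the lower half plane.
\<close>
lemma is_t_solution_iff_solves:
  assumes ev: "has_eigenvalues R l" and z: "0 < Im z"
  shows "is_t_solution c R z t \<longleftrightarrow> solves z t"
proof (cases "0 < Im t \<and> 0 < Im (z * t)")
  case True
  let ?k = "coeff_R c z t"
  have "0 < Im ?k" using Im_coeff_R(1) True by blast
  then have "Im (- z + (- ?k) * of_real (l i)) < 0" for i
    using add_pos_pos[OF z mult_pos_pos[OF \<open>0 < Im ?k\<close> l_pos[of i]]] by simp
  then have "- z + (- ?k) * of_real (l i) \<noteq> 0" for i by (metis less_irrefl zero_complex.sel(2))
  moreover have "- mat z - mat ?k ** R = mat (- z) + mat (- ?k) ** R"
  proof -
    have m: "mat (- k) = - mat k" for k :: complex by (simp add: mat_def vec_eq_iff)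
    show ?thesis unfolding m by (simp add: matrix_matrix_mult_def vec_eq_iff sum_negf)
  qed
  ultimately show ?thesis
    using ntrace_functional_calculus(1)[OF ev, of "- z" "- ?k"]
    by (simp add: is_t_solution_def solves_def upper_half_plane_def)
qed (auto simp: is_t_solution_def solves_def upper_half_plane_def)

section \<open>Explicit parametrisation of the solution\<close>

definition phi :: "complex \<Rightarrow> complex" where
  "phi v = mean (\<lambda>i. of_real (l i) / (of_real (l i) + v))"

definition psi :: "complex \<Rightarrow> complex" where
  "psi v = mean (\<lambda>i. 1 / (of_real (l i) + v))"

text \<open>
  With \<open>k = z / v\<close> one has \<open>- z - k l = - (z / v) (l + v)\<close>, so \<open>t = - (v / z) phi v\<close> is the average of
  \<open>l / (- z - k l)\<close> and \<open>z t\<close> that of \<open>l / (- 1 - l / v)\<close>.  All denominators lie in the lower half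
  plane, which places \<open>t\<close> and \<open>z t\<close> in the upper one.  The relation between \<open>z\<close> and \<open>v\<close> is exactly the
  condition that \<open>k\<close> is the coefficient belonging to this \<open>t\<close>, because it makes
  \<open>1 - z c\<^sup>2 t\<^sup>2\<close> equal to \<open>1 / (1 - c phi v)\<close>.
\<close>
lemma solves_of_parameter:
  assumes z: "0 < Im z" and v: "Im v < 0" "Im (v / z) < 0"
    and zv: "z = - (of_real c * v\<^sup>2 * phi v * (1 - of_real c * phi v))"
  shows "solves z (- (v / z) * phi v)" and "coeff_R c z (- (v / z) * phi v) = z / v"
proof -
  define t where "t = - (v / z) * phi v"
  have nz: "z \<noteq> 0" "v \<noteq> 0" using z v by auto
  have lv: "of_real (l i) + v \<noteq> 0" for i using v by (auto simp: complex_eq_iff)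
  have k: "0 < Im (z / v)" and v': "0 < Im (1 / v)"
    using v Im_inverse[of "v / z"] Im_inverse[of v] nz
    by (auto simp: divide_neg_pos inverse_eq_divide)
  have den: "- z - z / v * of_real (l i) = - (z / v * (of_real (l i) + v))"
    and den': "- 1 - 1 / v * of_real (l i) = - (1 / v * (of_real (l i) + v))" for i
    using nz by (simp_all add: field_simps)
  have t_mean: "t = mean (\<lambda>i. of_real (l i) / (- z - z / v * of_real (l i)))"
    unfolding t_def phi_def mean_cmult[symmetric] den
    using nz lv by (intro arg_cong[where f = mean] ext) simp
  have zt: "z * t = - v * phi v" using nz by (simp add: t_def)
  also have "\<dots> = mean (\<lambda>i. of_real (l i) / (- 1 - 1 / v * of_real (l i)))"
    unfolding phi_def mean_cmult[symmetric] den'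
    using nz lv by (intro arg_cong[where f = mean] ext) simp
  finally have zt_mean: "z * t = \<dots>" .
  have neg: "Im (- z - z / v * of_real (l i)) < 0" for i
    using add_pos_pos[OF z mult_pos_pos[OF k l_pos[of i]]] by (simp del: times_divide_eq_left)
  have "0 < Im t" unfolding t_mean Im_mean
    by (intro mean_pos Im_divide_real_pos l_pos neg)
  moreover have "0 < Im (z * t)" unfolding zt_mean Im_mean
    using v' l_pos by (intro mean_pos Im_divide_real_pos) (auto simp del: times_divide_eq_left)
  moreover have coeff: "coeff_R c z t = z / v"
  proof -
    define D where "D = 1 - of_real c * phi v"
    have D: "D \<noteq> 0" "phi v \<noteq> 0" using zv nz by (auto simp: D_def)
    have zD: "z = - (of_real c * v\<^sup>2 * phi v * D)" using zv by (simp add: D_def)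
    have "z * t\<^sup>2 = (z * t)\<^sup>2 / z" using nz by (simp add: power2_eq_square)
    also have "\<dots> = - phi v / (of_real c * D)"
      unfolding zt using nz D c_pos by (subst zD) (simp add: divide_simps power2_eq_square)
    finally have zt2: "z * t\<^sup>2 = - phi v / (of_real c * D)" .
    have "1 - z * (of_real c)\<^sup>2 * t\<^sup>2 = 1 - (of_real c)\<^sup>2 * (z * t\<^sup>2)" by (simp only: mult_ac)
    also have "\<dots> = 1 + of_real c * phi v / D"
      unfolding zt2 using D c_pos by (simp add: power2_eq_square)
    also have "\<dots> = 1 / D" using D by (simp add: divide_simps) (simp add: D_def)
    finally have "coeff_R c z t = of_real c * (z * t) * D"
      by (simp add: coeff_R_def mult_ac)
    also have "\<dots> = z / v"
      unfolding zt by (subst zD) (use nz in \<open>simp add: power2_eq_square\<close>)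
    finally show ?thesis .
  qed
  ultimately show "solves z (- (v / z) * phi v)" "coeff_R c z (- (v / z) * phi v) = z / v"
    using t_mean unfolding solves_def t_def[symmetric] by simp_all
qed

lemma t_nu_of_parameter:
  assumes ev: "has_eigenvalues R l"
    and z: "0 < Im z" and v: "Im v < 0" "Im (v / z) < 0"
    and zv: "z = - (of_real c * v\<^sup>2 * phi v * (1 - of_real c * phi v))"
  shows "t_nu c R z = - (v / z) * psi v"
proof -
  note sol = solves_of_parameter[OF z v zv]
  have t: "t_sol c R z = - (v / z) * phi v"
    unfolding t_sol_def
    using sol(1) solution_unique[OF z] by (intro the_equality) (auto simp: is_t_solution_iff_solves[OF ev z])
  have nz: "z \<noteq> 0" "v \<noteq> 0" using z v by auto
  have lv: "of_real (l i) + v \<noteq> 0" for i using v by (auto simp: complex_eq_iff)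
  have den: "z + z / v * of_real (l i) = z / v * (of_real (l i) + v)" for i
    using nz by (simp add: field_simps)
  have "t_nu c R z = - ntrace (matrix_inv (mat z + mat (z / v) ** R))"
    unfolding t_nu_def T_mat_def t sol(2) by (simp add: ntrace_def trace_def sum_negf)
  also have "\<dots> = - mean (\<lambda>i. 1 / (z + z / v * of_real (l i)))"
    using nz lv by (subst ntrace_functional_calculus(2)[OF ev]) (simp_all add: den del: times_divide_eq_left)
  also have "mean (\<lambda>i. 1 / (z + z / v * of_real (l i))) = v / z * psi v"
    unfolding den psi_def mean_cmult[symmetric] by simp
  finally show ?thesis by simp
qed

text \<open>
  This makes the factor \<open>1 - c phi v\<close> vanish to first order at \<open>v = 0\<close> when \<open>c = 1\<close>, and so
  produces the cubic instead of the quadratic singularity.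
\<close>
lemma phi_psi:
  assumes "\<And>i. of_real (l i) + v \<noteq> 0"
  shows "1 - phi v = v * psi v"
proof -
  have "1 - phi v = mean (\<lambda>i. 1 - of_real (l i) / (of_real (l i) + v))"
    by (simp add: phi_def mean_diff)
  also have "\<dots> = mean (\<lambda>i. v * (1 / (of_real (l i) + v)))"
    using assms by (intro arg_cong[where f = mean] ext) (simp add: field_simps)
  finally show ?thesis by (simp only: psi_def mean_cmult)
qed

text \<open>
  A convenient neighbourhood of \<open>0\<close> to the right of all the poles \<open>- l i\<close> of \<open>phi\<close> and \<open>psi\<close>.
\<close>
definition pole_free_half_plane :: "complex set" where
  "pole_free_half_plane = {v. - Min (range l) < Re v}"

lemma pole_free_half_plane:
  shows "open pole_free_half_plane" "0 \<in> pole_free_half_plane" and "v \<in> pole_free_half_plane \<Longrightarrow> of_real (l i) + v \<noteq> 0"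
proof -
  show "open pole_free_half_plane" unfolding pole_free_half_plane_def by (intro open_halfspace_Re_gt)
  have "0 < Min (range l)" using l_pos by simp
  then show "0 \<in> pole_free_half_plane" by (simp add: pole_free_half_plane_def)
  show "of_real (l i) + v \<noteq> 0" if "v \<in> pole_free_half_plane"
  proof -
    have "Min (range l) \<le> l i" by simp
    then have "0 < Re (of_real (l i) + v)" using that
      by (simp only: pole_free_half_plane_def mem_Collect_eq plus_complex.sel Re_complex_of_real)
    then show ?thesis by (metis less_irrefl zero_complex.sel(1))
  qed
qed

lemma holomorphic_phi [holomorphic_intros]: "phi holomorphic_on pole_free_half_plane"
  and holomorphic_psi [holomorphic_intros]: "psi holomorphic_on pole_free_half_plane"
  unfolding phi_def[abs_def] psi_def[abs_def] mean_def by (auto intro!: holomorphic_intros simp: pole_free_half_plane)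

end

section \<open>Boundary values on the positive axis\<close>

text \<open>
  Local inversion of \<open>z = - v\<^sup>m h(v)\<close> in terms of \<open>s = z\<^bsup>1/m\<^esup>\<close>: the map
  \<open>v \<mapsto> w v h(v)\<^bsup>1/m\<^esup>\<close> has nonzero derivative at \<open>0\<close>, and its \<open>m\<close>-th power is \<open>- v\<^sup>m h(v)\<close> because
  \<open>w\<close> is an \<open>m\<close>-th root of \<open>-1\<close>.  The choice of \<open>w\<close> selects one of the \<open>m\<close> branches.
\<close>
lemma root_branch:
  fixes h :: "complex \<Rightarrow> complex" and m :: nat
  assumes S: "open S" "0 \<in> S" and h: "h holomorphic_on S" "h 0 = of_real h0" "0 < h0"
    and w: "w ^ m = -1" and m: "0 < m"
  obtains V T where "open T" "0 \<in> T" "V holomorphic_on T" "V 0 = 0"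
    "\<And>s. s \<in> T \<Longrightarrow> V s \<in> S \<and> s ^ m = - (V s ^ m * h (V s))"
    "((\<lambda>s. V s / s) \<longlongrightarrow> 1 / (w * of_real (h0 powr (1 / m)))) (at 0)"
proof -
  \<comment> \<open>On \<open>S'\<close> the principal logarithm of \<open>h\<close> is holomorphic.\<close>
  define S' where "S' = S \<inter> h -` {u. 0 < Re u}"
  have S': "open S'" "0 \<in> S'" "S' \<subseteq> S" unfolding S'_def
    using S h(2,3) continuous_open_preimage[OF holomorphic_on_imp_continuous_on[OF h(1)] S(1)
        open_halfspace_Re_gt[of 0]] by auto
  define H where "H v = exp (Ln (h v) / of_nat m)" for v
  have "H holomorphic_on S'" unfolding H_def[abs_def]
    using m holomorphic_on_subset[OF h(1) S'(3)]
    by (intro holomorphic_intros) (auto simp: S'_def complex_nonpos_Reals_iff)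
  have Hm: "H v ^ m = h v" if "v \<in> S'" for v
  proof -
    have "H v ^ m = exp (Ln (h v))" using m by (simp add: H_def flip: exp_of_nat_mult)
    moreover have "h v \<noteq> 0" using that by (auto simp: S'_def)
    ultimately show ?thesis by simp
  qed
  have H0: "H 0 = of_real (h0 powr (1 / m))"
  proof -
    have "Ln (h 0) = of_real (ln h0)" using h by (simp add: Ln_of_real)
    then have "H 0 = exp (of_real (ln h0 / m))" by (simp add: H_def)
    then show ?thesis using h(3) by (simp only: exp_of_real powr_def) simp
  qed
  define G where "G v = w * v * H v" for v
  have G: "G holomorphic_on S'" unfolding G_def[abs_def]
    using \<open>H holomorphic_on S'\<close> by (intro holomorphic_intros)
  have "(H has_field_derivative deriv H 0) (at 0)"
    using \<open>H holomorphic_on S'\<close> S' holomorphic_derivI by blast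
  then have "(G has_field_derivative w * H 0) (at 0)"
    unfolding G_def[abs_def] by (auto intro!: derivative_eq_intros)
  then have G0: "deriv G 0 = w * H 0" by (rule DERIV_imp_deriv)
  have w0: "w \<noteq> 0" using w m by (metis neg_equal_0_iff_equal power_0_left zero_neq_one less_not_refl2)
  then have "deriv G 0 \<noteq> 0" by (simp add: G0 H_def)
  then obtain r where r: "r > 0" "ball 0 r \<subseteq> S'" "open (G ` ball 0 r)" "inj_on G (ball 0 r)"
    using has_complex_derivative_locally_invertible[OF G S'(2,1)] by blast
  obtain V where V: "V holomorphic_on G ` ball 0 r"
     "\<And>v. v \<in> ball 0 r \<Longrightarrow> deriv G v * deriv V (G v) = 1" "\<And>v. v \<in> ball 0 r \<Longrightarrow> V (G v) = v"
    using holomorphic_has_inverse[OF holomorphic_on_subset[OF G r(2)] open_ball r(4)] by blast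
  have G00: "G 0 = 0" by (simp add: G_def)
  have V0: "V 0 = 0" using V(3)[of 0] r(1) G00 by simp
  have 0: "0 \<in> G ` ball 0 r" using r(1) G00 by (metis centre_in_ball image_eqI)
  have dV: "deriv V 0 = 1 / (w * H 0)"
    using V(2)[of 0] r(1) \<open>deriv G 0 \<noteq> 0\<close> unfolding G00 G0
    by (simp add: nonzero_eq_divide_eq mult_ac)
  have "(V has_field_derivative deriv V 0) (at 0)"
    using V(1) r(3) 0 holomorphic_derivI by blast
  then have "((\<lambda>s. V s / s) \<longlongrightarrow> 1 / (w * H 0)) (at 0)"
    by (simp add: has_field_derivative_iff V0 dV)
  moreover have "V s \<in> S \<and> s ^ m = - (V s ^ m * h (V s))" if s: "s \<in> G ` ball 0 r" for s
  proof -
    obtain v where v: "v \<in> ball 0 r" "s = G v" using s by blast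
    then have "v \<in> S'" using r(2) by blast
    then show ?thesis using V(3)[OF v(1)] S'(3) Hm w v(2)
      by (auto simp: G_def power_mult_distrib)
  qed
  ultimately show thesis using that[OF r(3) 0 V(1) V0] H0 by simp
qed

lemma at_within_upper_half_plane: "at (of_real x) within upper_half_plane \<noteq> bot"
proof -
  have "of_real x islimpt upper_half_plane"
    unfolding islimpt_approachable
  proof (intro allI impI)
    fix e :: real assume "0 < e"
    then show "\<exists>y\<in>upper_half_plane. y \<noteq> of_real x \<and> dist y (of_real x) < e"
      by (intro bexI[of _ "Complex x (e / 2)"])
         (auto simp: upper_half_plane_def dist_norm complex_eq_iff cmod_def)
  qed
  then show ?thesis by (simp add: trivial_limit_within)
qed

context fixed_point_equation begin

text \<open>
  At the point \<open>s\<^sup>m\<close> of the positive axis the strict inequality \<open>Im (V s / s) < 0\<close> implies both sign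
  conditions of \<open>solves_of_parameter\<close>, because \<open>s\<close> is positive.  By continuity they persist for all
  nearby \<open>z\<close>, and there \<open>t_nu\<close> coincides with an expression that is continuous across the axis.
\<close>
lemma boundary_value:
  fixes m :: nat and h V :: "complex \<Rightarrow> complex" and s :: real
  assumes ev: "has_eigenvalues R l" and m: "0 < m"
    and h: "\<And>v. v \<in> pole_free_half_plane \<Longrightarrow> of_real c * v\<^sup>2 * phi v * (1 - of_real c * phi v) = v ^ m * h v"
    and T: "open T" and V: "V holomorphic_on T"
    and branch: "\<And>s. s \<in> T \<Longrightarrow> V s \<in> pole_free_half_plane \<and> s ^ m = - (V s ^ m * h (V s))"
    and s: "0 < s" "of_real s \<in> T" "Im (V (of_real s) / of_real s) < 0"
  shows "t_nu_boundary c R (s ^ m) = - (V (of_real s) / of_real s ^ m) * psi (V (of_real s))"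
proof -
  define x where "x = complex_of_real (s ^ m)"
  have x0: "x \<noteq> 0" using s by (simp add: x_def)
  have xpos: "x \<notin> \<real>\<^sub>\<le>\<^sub>0" using s by (simp add: x_def not_le del: of_real_power)
  define r where "r z = exp (Ln z / of_nat m)" for z
  have rx: "r x = of_real s"
  proof -
    have "Ln x = of_real (ln (s ^ m))" unfolding x_def using s by (intro Ln_of_real) simp
    also have "\<dots> = of_nat m * of_real (ln s)" using s by (simp add: ln_realpow)
    finally show ?thesis using s m by (simp add: r_def exp_of_real)
  qed
  have rm: "r z ^ m = z" if "z \<noteq> 0" for z
    using that m by (simp add: r_def flip: exp_of_nat_mult)
  have r_lim: "(r \<longlongrightarrow> of_real s) (at x within upper_half_plane)"
  proof -
    have "isCont r x" unfolding r_def using xpos m by (intro continuous_intros) auto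
    then show ?thesis using rx by (metis isCont_def tendsto_within_subset subset_UNIV)
  qed
  have "isCont V (of_real s)"
    using V T s(2) holomorphic_on_imp_continuous_on continuous_on_eq_continuous_at by blast
  then have V_lim: "((\<lambda>z. V (r z)) \<longlongrightarrow> V (of_real s)) (at x within upper_half_plane)"
    using r_lim by (rule isCont_tendsto_compose)
  have z_lim: "((\<lambda>z. z) \<longlongrightarrow> x) (at x within upper_half_plane)" by (rule tendsto_ident_at)
  have Vs: "V (of_real s) \<in> pole_free_half_plane" using branch s(2) by blast
  have "isCont psi (V (of_real s))"
    using holomorphic_psi pole_free_half_plane(1) Vs holomorphic_on_imp_continuous_on continuous_on_eq_continuous_at by blast
  then have "((\<lambda>z. - (V (r z) / z) * psi (V (r z))) \<longlongrightarrow> - (V (of_real s) / x) * psi (V (of_real s)))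
      (at x within upper_half_plane)"
    using x0 by (intro tendsto_intros V_lim isCont_tendsto_compose[OF _ V_lim]) auto
  moreover have "\<forall>\<^sub>F z in at x within upper_half_plane. - (V (r z) / z) * psi (V (r z)) = t_nu c R z"
  proof -
    have sgn: "Im (V (of_real s)) < 0" "Im (V (of_real s) / x) < 0"
    proof -
      have "V (of_real s) = of_real s * (V (of_real s) / of_real s)" using s by simp
      then show Vneg: "Im (V (of_real s)) < 0"
        using s by (simp add: divide_less_0_iff)
      then show "Im (V (of_real s) / x) < 0"
        using s unfolding x_def by (simp add: divide_less_0_iff del: of_real_power)
    qed
    have "\<forall>\<^sub>F z in at x within upper_half_plane. r z \<in> T"
      using r_lim T s(2) by (rule topological_tendstoD)
    moreover have "\<forall>\<^sub>F z in at x within upper_half_plane. Im (V (r z)) < 0"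
      using tendsto_Im[OF V_lim] sgn(1) by (rule order_tendstoD)
    moreover have "\<forall>\<^sub>F z in at x within upper_half_plane. Im (V (r z) / z) < 0"
      using tendsto_Im[OF tendsto_divide[OF V_lim z_lim x0]] sgn(2) by (rule order_tendstoD)
    moreover have "\<forall>\<^sub>F z in at x within upper_half_plane. z \<in> upper_half_plane"
      by (simp add: eventually_at_topological) blast
    ultimately show ?thesis
    proof eventually_elim
      case (elim z)
      then have z: "0 < Im z" by (simp add: upper_half_plane_def)
      then have "z \<noteq> 0" by auto
      then have "z = r z ^ m" by (rule rm[symmetric])
      also have "\<dots> = - (of_real c * (V (r z))\<^sup>2 * phi (V (r z)) * (1 - of_real c * phi (V (r z))))"
        using branch[of "r z"] h[of "V (r z)"] elim(1) by simp
      finally show ?case by (rule t_nu_of_parameter[OF ev z elim(2,3), symmetric])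
    qed
  qed
  ultimately have "(t_nu c R \<longlongrightarrow> - (V (of_real s) / x) * psi (V (of_real s))) (at x within upper_half_plane)"
    by (rule Lim_transform_eventually)
  then have "Lim (at x within upper_half_plane) (t_nu c R) = - (V (of_real s) / x) * psi (V (of_real s))"
    unfolding x_def by (rule tendsto_Lim[OF at_within_upper_half_plane])
  then show ?thesis
    by (simp only: t_nu_boundary_def x_def of_real_power)
qed

text \<open>
  As \<open>s \<longlongrightarrow> 0\<close> the quotient \<open>V s / s\<close> tends to \<open>1 / (w h0 powr (1/m))\<close>, whose imaginary part is
  negative because \<open>w\<close> is a unit vector in the upper half plane.  Hence \<open>boundary_value\<close> applies
  for small \<open>s\<close>, and \<open>s\<^bsup>m-1\<^esup>\<close> times the density at \<open>x = s\<^sup>m\<close> is the imaginary part of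
  \<open>- (V s / s) psi (V s) / \<pi>\<close>.
\<close>
lemma g_density_limit:
  fixes m :: nat and h :: "complex \<Rightarrow> complex"
  assumes ev: "has_eigenvalues R l" and m: "0 < m" and w: "w ^ m = -1" "0 < Im w"
    and h: "\<And>v. v \<in> pole_free_half_plane \<Longrightarrow> of_real c * v\<^sup>2 * phi v * (1 - of_real c * phi v) = v ^ m * h v"
    and hol: "h holomorphic_on pole_free_half_plane" and h0: "h 0 = of_real h0" "0 < h0"
  shows "((\<lambda>x. g_density c R x * x powr ((m - 1) / m))
           \<longlongrightarrow> Im w / h0 powr (1 / m) * mean (\<lambda>i. 1 / l i) / pi) (at_right 0)"
proof -
  obtain V T where T: "open T" "0 \<in> T" and V: "V holomorphic_on T" "V 0 = 0"
    and branch: "\<And>s. s \<in> T \<Longrightarrow> V s \<in> pole_free_half_plane \<and> s ^ m = - (V s ^ m * h (V s))"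
    and lim: "((\<lambda>s. V s / s) \<longlongrightarrow> 1 / (w * of_real (h0 powr (1 / m)))) (at 0)"
    by (rule root_branch[OF pole_free_half_plane(1,2) hol h0 w(1) m]) (rule that)
  have "cmod w = 1"
  proof -
    have "cmod w ^ m = 1" using w(1) by (metis norm_power norm_minus_cancel norm_one)
    then show ?thesis using m by (intro power_eq_imp_eq_base[of "cmod w" m 1]) auto
  qed
  define \<rho> where "\<rho> = h0 powr (1 / m)"
  have \<rho>: "0 < \<rho>" using h0 by (simp add: \<rho>_def)
  have Im_lim: "Im (1 / (w * of_real \<rho>)) = - Im w / \<rho>"
  proof -
    have "Im (1 / (w * of_real \<rho>)) = Im (inverse w) / \<rho>"
      by (simp add: divide_inverse mult.commute[of "inverse w"] flip: of_real_inverse del: inverse_complex.sel)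
    then show ?thesis using \<open>cmod w = 1\<close> by (simp only: Im_inverse) simp
  qed
  have of_real_lim: "filterlim complex_of_real (at 0) (at_right 0)"
    unfolding filterlim_at
    by (auto intro!: tendsto_eq_intros simp: eventually_at_filter)
  have root_lim: "filterlim (\<lambda>x. x powr (1 / m)) (at_right 0) (at_right (0::real))"
    using m by real_asymp
  have quot: "((\<lambda>s. V (of_real s) / of_real s) \<longlongrightarrow> 1 / (w * of_real \<rho>)) (at_right (0::real))"
    using filterlim_compose[OF lim of_real_lim] by (simp add: \<rho>_def)
  have id: "((\<lambda>s. complex_of_real s) \<longlongrightarrow> 0) (at_right 0)"
    by (auto intro!: tendsto_eq_intros)
  have "isCont V 0"
    using V T holomorphic_on_imp_continuous_on continuous_on_eq_continuous_at by blast
  then have V_lim: "((\<lambda>s. V (of_real s)) \<longlongrightarrow> 0) (at_right (0::real))"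
    using isCont_tendsto_compose[OF _ id] V(2) by metis
  have "isCont psi 0"
    using holomorphic_psi pole_free_half_plane(1,2) holomorphic_on_imp_continuous_on continuous_on_eq_continuous_at by blast
  then have psi_lim: "((\<lambda>s. psi (V (of_real s))) \<longlongrightarrow> psi 0) (at_right (0::real))"
    using isCont_tendsto_compose[OF _ V_lim] by metis
  have psi0: "psi 0 = of_real (mean (\<lambda>i. 1 / l i))"
    by (simp add: psi_def of_real_mean)
  define F where "F s = - Im (V (of_real s) / of_real s * psi (V (of_real s))) / pi" for s :: real
  have "(F \<longlongrightarrow> - Im (1 / (w * of_real \<rho>) * psi 0) / pi) (at_right 0)"
    unfolding F_def by (intro tendsto_intros quot psi_lim) auto
  also have "- Im (1 / (w * of_real \<rho>) * psi 0) = Im w / \<rho> * mean (\<lambda>i. 1 / l i)"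
    unfolding psi0 using Im_lim by (simp del: Im_divide times_divide_eq_left)
  finally have F_lim: "(F \<longlongrightarrow> Im w / \<rho> * mean (\<lambda>i. 1 / l i) / pi) (at_right 0)" .
  have "((\<lambda>x. F (x powr (1 / m))) \<longlongrightarrow> Im w / \<rho> * mean (\<lambda>i. 1 / l i) / pi) (at_right 0)"
    by (rule filterlim_compose[OF F_lim root_lim])
  moreover have "\<forall>\<^sub>F x in at_right 0. F (x powr (1 / m)) = g_density c R x * x powr ((m - 1) / m)"
  proof -
    have "\<forall>\<^sub>F s in at_right (0::real). 0 < s" by (simp add: eventually_at_right_less)
    moreover have "\<forall>\<^sub>F s in at_right (0::real). of_real s \<in> T"
      using id T by (rule topological_tendstoD)
    moreover have "\<forall>\<^sub>F s in at_right (0::real). Im (V (of_real s) / of_real s) < 0"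
      using tendsto_Im[OF quot] w(2) \<rho> Im_lim by (intro order_tendstoD(2)[of _ "- Im w / \<rho>"]) auto
    ultimately have "\<forall>\<^sub>F s in at_right (0::real). F s = g_density c R (s ^ m) * s ^ (m - 1)"
    proof eventually_elim
      case (elim s)
      have "g_density c R (s ^ m) = - Im (V (of_real s) / of_real (s ^ m) * psi (V (of_real s))) / pi"
        using boundary_value[OF ev m h T(1) V(1) branch elim] by (simp add: g_density_def)
      also have "V (of_real s) / of_real (s ^ m) * psi (V (of_real s))
          = of_real (1 / s ^ (m - 1)) * (V (of_real s) / of_real s * psi (V (of_real s)))"
        using elim m by (cases m) (auto simp: field_simps)
      finally show ?case using elim by (simp add: F_def)
    qed
    then have "\<forall>\<^sub>F x in at_right (0::real). F (x powr (1 / m))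
        = g_density c R ((x powr (1 / m)) ^ m) * (x powr (1 / m)) ^ (m - 1)"
      using root_lim by (rule eventually_compose_filterlim)
    moreover have "\<forall>\<^sub>F x in at_right (0::real). 0 < x" by (simp add: eventually_at_right_less)
    ultimately show ?thesis
    proof eventually_elim
      case (elim x)
      then show ?case using m by (simp add: powr_powr flip: powr_realpow)
    qed
  qed
  ultimately show ?thesis unfolding \<rho>_def by (rule Lim_transform_eventually)
qed

end

section \<open>The density near zero\<close>

lemma asymp_equiv_powr_at_right_0:
  fixes f g :: "real \<Rightarrow> real"
  assumes lim: "((\<lambda>x. f x * x powr e) \<longlongrightarrow> K) (at_right 0)" and "K \<noteq> 0"
    and g: "\<And>x. 0 < x \<Longrightarrow> g x = K / x powr e"
  shows "f \<sim>[at_right 0] g"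
proof (rule asymp_equivI')
  have "((\<lambda>x. f x * x powr e / K) \<longlongrightarrow> K / K) (at_right 0)"
    by (intro tendsto_divide lim tendsto_const assms(2))
  moreover have "\<forall>\<^sub>F x in at_right 0. f x * x powr e / K = f x / g x"
    using eventually_at_right_less[of 0] by eventually_elim (simp add: g)
  ultimately show "((\<lambda>x. f x / g x) \<longlongrightarrow> 1) (at_right 0)"
    using \<open>K \<noteq> 0\<close> by (simp add: tendsto_cong)
qed

theorem proposition10:
  fixes R :: "complex^'m^'m" and a b c :: real and N L :: nat
  assumes "N \<ge> 1" and "L \<ge> 1"
    and "c = real CARD('m) * real L / real N"
    and "0 < a" and "a < b"
    and "hermitian R"
    and "loewner_le (mat (of_real a)) R"
    and "loewner_less R (mat (of_real b))"
  shows "(c < 1 \<longrightarrow>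
            g_density c R \<sim>[at_right 0]
              (\<lambda>x. 1 / pi * (1 / sqrt (c * (1 - c))) * Re (ntrace (matrix_inv R)) * (1 / sqrt x)))
       \<and> (c = 1 \<longrightarrow>
            g_density c R \<sim>[at_right 0]
              (\<lambda>x. 1 / pi * (sqrt 3 / 2) * Re (ntrace (matrix_inv R)) powr (2/3) * (1 / x powr (2/3))))"
proof -
  have "c > 0" using assms(1-3) by simp
  obtain l where ev: "has_eigenvalues R l" and l: "\<And>i. 0 < l i"
    by (rule hermitian_has_positive_eigenvalues[OF assms(6,4,7)]) (rule that)
  interpret fixed_point_equation c l
    by unfold_locales (use \<open>c > 0\<close> l in auto)
  define \<mu> where "\<mu> = mean (\<lambda>i. 1 / l i)"
  have \<mu>: "0 < \<mu>" unfolding \<mu>_def using l by (intro mean_pos) simp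
  have tr: "Re (ntrace (matrix_inv R)) = \<mu>"
  proof -
    have "mat 0 = (0 :: complex^'m^'m)" by (simp add: vec_eq_iff mat_def)
    then have "mat 0 + mat 1 ** R = R" by simp
    then have "ntrace (matrix_inv R) = mean (\<lambda>i. 1 / of_real (l i))"
      using ntrace_functional_calculus(2)[OF ev, of 0 1] l by (simp add: less_imp_neq[THEN not_sym])
    also have "\<dots> = of_real \<mu>" by (simp add: \<mu>_def of_real_mean)
    finally show ?thesis by simp
  qed
  have phi0: "phi 0 = 1" and psi0: "psi 0 = of_real \<mu>"
    using l by (simp_all add: phi_def psi_def \<mu>_def of_real_mean less_imp_neq[THEN not_sym])
  have "g_density c R \<sim>[at_right 0]
      (\<lambda>x. 1 / pi * (1 / sqrt (c * (1 - c))) * Re (ntrace (matrix_inv R)) * (1 / sqrt x))" if "c < 1"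
  proof -
    \<comment> \<open>Here \<open>z = - v\<^sup>2 h v\<close>, and \<open>\<i>\<close> is the square root of \<open>-1\<close> in the upper half plane.\<close>
    define h where "h v = of_real c * phi v * (1 - of_real c * phi v)" for v
    have pos: "0 < c * (1 - c)" using \<open>c > 0\<close> that by simp
    have "((\<lambda>x. g_density c R x * x powr (real (2 - 1) / real 2))
        \<longlongrightarrow> Im \<i> / (c * (1 - c)) powr (1 / real 2) * mean (\<lambda>i. 1 / l i) / pi) (at_right 0)"
    proof (rule g_density_limit[OF ev, of 2 \<i> h])
      show "h holomorphic_on pole_free_half_plane"
        unfolding h_def[abs_def] by (intro holomorphic_intros)
    qed (use pos in \<open>simp_all add: h_def phi0 power2_eq_square\<close>)
    then have "((\<lambda>x. g_density c R x * x powr (1 / 2)) \<longlongrightarrow> \<mu> / sqrt (c * (1 - c)) / pi) (at_right 0)"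
      using pos by (simp add: powr_half_sqrt \<mu>_def)
    then show ?thesis
      by (rule asymp_equiv_powr_at_right_0) (use \<mu> \<open>c > 0\<close> that in \<open>simp_all add: tr powr_half_sqrt\<close>)
  qed
  moreover have "g_density c R \<sim>[at_right 0]
      (\<lambda>x. 1 / pi * (sqrt 3 / 2) * Re (ntrace (matrix_inv R)) powr (2/3) * (1 / x powr (2/3)))" if "c = 1"
  proof -
    \<comment> \<open>Here \<open>z = - v\<^sup>3 h v\<close> since \<open>1 - phi v = v psi v\<close>.  Of the cube roots of \<open>-1\<close> only
       \<open>cis (\<pi> / 3)\<close> lies in the upper half plane.\<close>
    define h where "h v = phi v * psi v" for v
    have root: "cis (pi / 3) ^ 3 = -1" by (simp only: Complex.DeMoivre) simp
    have "((\<lambda>x. g_density c R x * x powr (real (3 - 1) / real 3))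
        \<longlongrightarrow> Im (cis (pi / 3)) / \<mu> powr (1 / real 3) * mean (\<lambda>i. 1 / l i) / pi) (at_right 0)"
    proof (rule g_density_limit[OF ev, of 3 "cis (pi / 3)" h])
      show "h holomorphic_on pole_free_half_plane"
        unfolding h_def[abs_def] by (intro holomorphic_intros)
      show "of_real c * v\<^sup>2 * phi v * (1 - of_real c * phi v) = v ^ 3 * h v"
        if "v \<in> pole_free_half_plane" for v
        using phi_psi[OF pole_free_half_plane(3)[OF that]] \<open>c = 1\<close>
        by (simp add: h_def power2_eq_square power3_eq_cube)
    qed (use \<mu> in \<open>simp_all add: h_def phi0 psi0 root sin_60\<close>)
    moreover have "\<mu> powr (2 / 3) = \<mu> / \<mu> powr (1 / 3)"
    proof -
      have "\<mu> / \<mu> powr (1 / 3) = \<mu> powr (1 - 1 / 3)" using \<mu> by (simp only: powr_diff) simp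
      then show ?thesis by simp
    qed
    ultimately have "((\<lambda>x. g_density c R x * x powr (2 / 3)) \<longlongrightarrow> sqrt 3 / 2 * \<mu> powr (2 / 3) / pi) (at_right 0)"
      by (simp add: sin_60 flip: \<mu>_def)
    then show ?thesis
      by (rule asymp_equiv_powr_at_right_0) (use \<mu> in \<open>simp_all add: tr\<close>)
  qed
  ultimately show ?thesis by blast
qed

end
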